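(* Let $n\ge 1$. For every bounded Lipschitz domain $\Omega\subset\mathbb{R}^n$ there exist constants $c,C>0$, depending only on $n$ and the Lipschitz character of $\Omega$, such that for every $\lambda>0$, $$c\big(|\Omega|+\lambda\,\mathcal{H}^{n-1}(\partial\Omega)\big)\le\mu_\lambda(\Omega)\le C\big(|\Omega|+\lambda\,\mathcal{H}^{n-1}(\partial\Omega)\big).$$
   Context: Work in $\mathbb{R}^n$ with the Euclidean metric; $\operatorname{diam}$ is Euclidean diameter, $|E|$ is Lebesgue measure of $E$, and $\mathcal{H}^{s}$ is $s$-dimensional Hausdorff measure. For $\lambda>0$ the mixed gauge is $h_\lambda(r)=r^n+\lambda r^{n-1}$ for $r>0$, with $h_\lambda(0)=0$. For $E\subset\mathbb{R}^n$ define $$\mu_\lambda(E):=\inf\Big\{\sum_i \big((\operatorname{diam} U_i)^n+\lambda(\operatorname{diam} U_i)^{n-1}\big) : E\subset\bigcup_i U_i\Big\},$$ where the infimum is over all at most countable families $(U_i)$ of balls (or, alternatively, of cubes; the choice of family is fixed once and for all, and the claim is made for either choice) of positive diameter, the empty family being allowed for $E=\emptyset$, so $\mu_\lambda(\emptyset)=0$. There is no restriction on the size of the diameters. The Lipschitz character of a bounded Lipschitz domain $\Omega$ means the parameters of a finite atlas of local charts in which $\Omega$ is, after a rigid motion, the region above the graph of a Lipschitz function: the number of charts, their size, and a common bound on the Lipschitz constants. *)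

theory Defs
  imports "HOL-Analysis.Analysis"
begin

text \<open>
  The normalization is the one for which \<open>\<H>\<^sup>n\<close> is Lebesgue measure on \<open>n\<close>-dimensional Euclidean
  space and \<open>\<H>\<^sup>0\<close> is counting measure.  The case distinction matters for \<open>s = 0\<close> only, where the
  empty set has to contribute \<open>0\<close> but a point \<open>0 ^ 0 = 1\<close>.
\<close>

definition hausdorff_gauge :: "nat \<Rightarrow> 'a::metric_space set \<Rightarrow> ennreal" where
  "hausdorff_gauge s U =
     (if U = {} then 0 else ennreal (unit_ball_vol (real s) * (diameter U / 2) ^ s))"

text \<open>Boundedness is required separately because \<^const>\<open>diameter\<close> is real-valued.\<close>

definition hausdorff_premeasure :: "nat \<Rightarrow> real \<Rightarrow> 'a::metric_space set \<Rightarrow> ennreal" where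
  "hausdorff_premeasure s \<delta> E =
     Inf {\<Sum>i. hausdorff_gauge s (U i) | U :: nat \<Rightarrow> 'a set.
            (\<forall>i. bounded (U i) \<and> diameter (U i) \<le> \<delta>) \<and> E \<subseteq> (\<Union>i. U i)}"

definition hausdorff_measure :: "nat \<Rightarrow> 'a::metric_space set \<Rightarrow> ennreal" where
  "hausdorff_measure s E = (SUP \<delta>\<in>{0<..}. hausdorff_premeasure s \<delta> E)"

definition open_balls :: "(real ^ 'n) set set" where
  "open_balls = {ball x r | x r. 0 < r}"

definition closed_balls :: "(real ^ 'n) set set" where
  "closed_balls = {cball x r | x r. 0 < r}"

definition open_cubes :: "(real ^ 'n) set set" where
  "open_cubes = {box a (\<chi> i. a $ i + s) | a s. 0 < s}"

definition closed_cubes :: "(real ^ 'n) set set" where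
  "closed_cubes = {cbox a (\<chi> i. a $ i + s) | a s. 0 < s}"

text \<open>
  At most countable families are indexed by a subset of \<^typ>\<open>nat\<close>, so finite families and the
  empty one are included.
\<close>

definition mixed_content ::
  "(real ^ 'n) set set \<Rightarrow> real \<Rightarrow> (real ^ 'n) set \<Rightarrow> ennreal" where
  "mixed_content \<F> lam E =
     Inf {\<Sum>\<^sub>\<infinity>i\<in>I. ennreal (diameter (U i) ^ CARD('n) + lam * diameter (U i) ^ (CARD('n) - 1))
          | (I :: nat set) U. (\<forall>i\<in>I. U i \<in> \<F>) \<and> E \<subseteq> (\<Union>i\<in>I. U i)}"

text \<open>
  Reflections are admitted: for \<open>n = 1\<close> they are needed to write both end points of an interval as
  graphs with the domain above; for \<open>n \<ge> 2\<close> they can be absorbed into the graph function.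
\<close>

definition rigid_motion :: "(real ^ 'n \<Rightarrow> real ^ 'n) \<Rightarrow> bool" where
  "rigid_motion f \<longleftrightarrow> (\<exists>a g. orthogonal_transformation g \<and> f = (\<lambda>x. a + g x))"

text \<open>
  The hyperplane \<open>{y. y $ j = 0}\<close> plays the role of \<open>(n-1)\<close>-dimensional space, and \<open>\<phi>\<close> is evaluated
  only on it.
\<close>

definition above_graph :: "'n \<Rightarrow> (real ^ 'n \<Rightarrow> real) \<Rightarrow> (real ^ 'n) set" where
  "above_graph j \<phi> = {y. \<phi> (\<chi> i. if i = j then 0 else y $ i) < y $ j}"

definition lipschitz_chart :: "(real ^ 'n) set \<Rightarrow> real \<Rightarrow> real \<Rightarrow> real ^ 'n \<Rightarrow> bool" where
  "lipschitz_chart \<Omega> r L p \<longleftrightarrow>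
     (\<exists>f j \<phi>. rigid_motion f \<and> L-lipschitz_on {y. y $ j = 0} \<phi> \<and>
        \<Omega> \<inter> ball p r = f ` above_graph j \<phi> \<inter> ball p r)"

text \<open>
  Lipschitz character: \<open>N\<close> charts, each a ball of radius \<open>r\<close> centred on the boundary, with \<open>L\<close> a
  common bound on the Lipschitz constants.  A set is a bounded Lipschitz domain iff it has some
  Lipschitz character \<open>(N, r, L)\<close>: charts of varying sizes and shapes reduce to this form by the
  Lebesgue number lemma.
\<close>

definition has_lipschitz_character :: "(real ^ 'n) set \<Rightarrow> nat \<Rightarrow> real \<Rightarrow> real \<Rightarrow> bool" where
  "has_lipschitz_character \<Omega> N r L \<longleftrightarrow>
     0 < r \<and>
     (\<exists>p. (\<forall>k<N. p k \<in> frontier \<Omega> \<and> lipschitz_chart \<Omega> r L (p k)) \<and>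
          frontier \<Omega> \<subseteq> (\<Union>k<N. ball (p k) r))"

definition bounded_domain :: "(real ^ 'n) set \<Rightarrow> bool" where
  "bounded_domain \<Omega> \<longleftrightarrow> open \<Omega> \<and> connected \<Omega> \<and> \<Omega> \<noteq> {} \<and> bounded \<Omega>"

end

theory Submission
  imports Defs
begin

text \<open>
  The constants may depend on \<open>N\<close>, \<open>r\<close> and \<open>L\<close>, so it suffices to compare every quantity with a
  constant.  A chart contributes a ball of radius comparable to \<open>r\<close> to \<open>\<Omega>\<close>; the shadow of this
  ball bounds the measure of the frontier from below, and the charts cover the frontier by \<open>N\<close>
  Lipschitz graphs, which bounds it from above.  For \<open>n \<ge> 2\<close> connectedness bounds the diameter of
  \<open>\<Omega>\<close> by a multiple of \<open>r * (N + 1)\<close>, and a single covering set gives the upper bound; only an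
  interval can be arbitrarily long, but its length is its volume.  For the lower bound, any cover
  satisfies \<open>\<Sum> d\<^sub>i ^ n \<ge> |\<Omega>| / 2 ^ n\<close>, and this forces \<open>\<Sum> d\<^sub>i ^ (n - 1)\<close> to be bounded below as well.
\<close>

section \<open>Series over index sets and volumes of cubes\<close>

text \<open>Every family in \<open>ennreal\<close> is summable, so extending by zero turns the
  unordered sum in \<open>mixed_content\<close> into a series, to which additivity and comparison
  results for \<open>suminf\<close> apply.\<close>

lemma infsum_ennreal_eq_suminf:
  fixes f :: "nat \<Rightarrow> ennreal"
  shows "(\<Sum>\<^sub>\<infinity>i\<in>I. f i) = (\<Sum>i. if i \<in> I then f i else 0)"
proof -
  let ?g = "\<lambda>i. if i \<in> I then f i else 0"
  have "(\<Sum>\<^sub>\<infinity>i\<in>I. f i) = infsum ?g UNIV"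
    by (rule infsum_cong_neutral) auto
  moreover have "(?g has_sum infsum ?g UNIV) UNIV"
    by (intro has_sum_infsum nonneg_summable_on_complete) simp
  ultimately show ?thesis
    by (auto dest!: has_sum_imp_sums sums_unique)
qed

lemma emeasure_lebesgue_cbox_cart:
  fixes a b :: "real ^ 'n"
  assumes "\<And>i. a $ i \<le> b $ i"
  shows "emeasure lebesgue (cbox a b) = ennreal (\<Prod>i\<in>UNIV. b $ i - a $ i)"
proof -
  have "cbox a b \<noteq> {}"
    using assms by (metis interval_ne_empty_cart(1))
  then have "measure lborel (cbox a b) = (\<Prod>i\<in>UNIV. b $ i - a $ i)"
    by (rule content_cbox_cart)
  moreover have "emeasure lborel (cbox a b) = ennreal (measure lborel (cbox a b))"
    by (rule emeasure_eq_ennreal_measure) (use emeasure_lborel_cbox_finite[of a b] in auto)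
  ultimately show ?thesis
    by simp
qed

lemma emeasure_le_suminf_cover:
  assumes "E \<subseteq> (\<Union>i::nat. V i)" "\<And>i. V i \<in> sets M"
  shows "emeasure M E \<le> (\<Sum>i. emeasure M (V i))"
proof -
  have "emeasure M E \<le> emeasure M (\<Union>i. V i)"
    using assms by (intro emeasure_mono) auto
  also have "\<dots> \<le> (\<Sum>i. emeasure M (V i))"
    using assms by (intro emeasure_subadditive_countably) auto
  finally show ?thesis .
qed

text \<open>The cube centred at a point of \<open>U\<close> with half side \<open>diameter U\<close>
  works, because a coordinate difference never exceeds the distance. The crude factor
  \<open>2 ^ n\<close> stands in for an isodiametric inequality, and \<open>V\<close> is measurable
  even if \<open>U\<close> is not.\<close>

lemma bounded_subset_cube:
  fixes U :: "(real ^ 'n) set"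
  assumes "bounded U"
  obtains V where "U \<subseteq> V" "V \<in> sets lebesgue" "emeasure lebesgue V \<le> ennreal ((2 * diameter U) ^ CARD('n))"
proof (cases "U = {}")
  case True
  then show ?thesis using that[of "{}"] by simp
next
  case False
  then obtain x where x: "x \<in> U" by auto
  define d where "d = diameter U"
  have d: "0 \<le> d" unfolding d_def using assms by (rule diameter_ge_0)
  define V where "V = cbox (\<chi> i. x $ i - d) (\<chi> i. x $ i + d)"
  have "U \<subseteq> V"
  proof
    fix y assume "y \<in> U"
    then have "dist x y \<le> d"
      unfolding d_def using assms x by (intro diameter_bounded_bound)
    then have *: "\<bar>x $ i - y $ i\<bar> \<le> d" for i
      using component_le_norm_cart[of "x - y" i] by (simp add: dist_norm)
    have "x $ i - d \<le> y $ i \<and> y $ i \<le> x $ i + d" for i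
      using *[of i] by arith
    then show "y \<in> V"
      by (simp add: V_def mem_box_cart)
  qed
  moreover have "emeasure lebesgue V = ennreal ((2 * d) ^ CARD('n))"
  proof -
    have "emeasure lebesgue V = ennreal (\<Prod>i\<in>(UNIV :: 'n set). (x $ i + d) - (x $ i - d))"
      unfolding V_def using d by (subst emeasure_lebesgue_cbox_cart) simp_all
    also have "(\<Prod>i\<in>(UNIV :: 'n set). (x $ i + d) - (x $ i - d)) = (2 * d) ^ CARD('n)"
    proof -
      have "(x $ i + d) - (x $ i - d) = 2 * d" for i by simp
      then show ?thesis by (simp only: prod_constant)
    qed
    finally show ?thesis .
  qed
  moreover have "V \<in> sets lebesgue"
    by (simp add: V_def)
  ultimately show ?thesis
    using that unfolding d_def by (metis order_refl)
qed

section \<open>Bounds for the mixed content\<close>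

lemma mixed_content_le:
  fixes U :: "(real ^ 'n) set"
  assumes "U \<in> \<F>" "E \<subseteq> U"
  shows "mixed_content \<F> lam E \<le> ennreal (diameter U ^ CARD('n) + lam * diameter U ^ (CARD('n) - 1))"
proof -
  have "(\<Sum>\<^sub>\<infinity>i\<in>{0::nat}. ennreal (diameter U ^ CARD('n) + lam * diameter U ^ (CARD('n) - 1)))
      = ennreal (diameter U ^ CARD('n) + lam * diameter U ^ (CARD('n) - 1))"
    by simp
  then show ?thesis
    unfolding mixed_content_def using assms
    by (intro Inf_lower CollectI exI[of _ "{0::nat}"] exI[of _ "\<lambda>_. U"]) auto
qed

text \<open>
  If some covering set has diameter at least \<open>1\<close>, then it alone contributes \<open>lam\<close> to the lower order
  term; otherwise \<open>d ^ (n - 1) \<ge> d ^ n\<close> for all of them and the volume bound applies.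
\<close>

lemma mixed_content_ge:
  fixes E :: "(real ^ 'n) set"
  assumes bdd: "\<And>U. U \<in> \<F> \<Longrightarrow> bounded U"
    and v: "0 < v" "ennreal v \<le> emeasure lebesgue E" and lam: "0 < lam"
  shows "ennreal (1 / 2 ^ CARD('n)) * emeasure lebesgue E + ennreal (lam * min 1 (v / 2 ^ CARD('n)))
    \<le> mixed_content \<F> lam E"
  unfolding mixed_content_def
proof (rule Inf_greatest, clarify)
  fix I :: "nat set" and U :: "nat \<Rightarrow> (real ^ 'n) set"
  assume U: "\<forall>i\<in>I. U i \<in> \<F>" and E: "E \<subseteq> (\<Union>i\<in>I. U i)"
  let ?n = "CARD('n)"
  define a where "a i = (if i \<in> I then ennreal (diameter (U i) ^ ?n) else 0)" for i
  define b where "b i = (if i \<in> I then ennreal (diameter (U i) ^ (?n - 1)) else 0)" for i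
  have d0: "0 \<le> diameter (U i)" if "i \<in> I" for i
    using that U bdd by (blast intro: diameter_ge_0)
  \<comment> \<open>Each covering set is replaced by a measurable superset of comparable volume;
    indices outside \<open>I\<close> receive the empty set, so that countable subadditivity applies
    to the full sequence.\<close>
  have "\<forall>i. \<exists>V. (i \<in> I \<longrightarrow> U i \<subseteq> V) \<and> V \<in> sets lebesgue \<and>
      emeasure lebesgue V \<le> ennreal (2 ^ ?n) * a i"
  proof
    fix i
    show "\<exists>V. (i \<in> I \<longrightarrow> U i \<subseteq> V) \<and> V \<in> sets lebesgue \<and>
      emeasure lebesgue V \<le> ennreal (2 ^ ?n) * a i"
    proof (cases "i \<in> I")
      case True
      then obtain V where "U i \<subseteq> V" "V \<in> sets lebesgue"
        "emeasure lebesgue V \<le> ennreal ((2 * diameter (U i)) ^ CARD('n))"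
        using bounded_subset_cube[of "U i"] U bdd by blast
      then show ?thesis
        using True d0[of i] by (intro exI[of _ V]) (simp add: a_def power_mult_distrib ennreal_mult)
    next
      case False
      then show ?thesis by (intro exI[of _ "{}"]) simp
    qed
  qed
  from choice[OF this] obtain V where V: "\<And>i. i \<in> I \<Longrightarrow> U i \<subseteq> V i" "\<And>i. V i \<in> sets lebesgue"
      "\<And>i. emeasure lebesgue (V i) \<le> ennreal (2 ^ ?n) * a i"
    by blast
  have "emeasure lebesgue E \<le> (\<Sum>i. emeasure lebesgue (V i))"
  proof (rule emeasure_le_suminf_cover)
    show "E \<subseteq> (\<Union>i. V i)"
    proof
      fix x assume "x \<in> E"
      then obtain i where "i \<in> I" "x \<in> U i" using E by auto
      then show "x \<in> (\<Union>i. V i)"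
        using V(1)[of i] by auto
    qed
  qed (rule V(2))
  also have "\<dots> \<le> (\<Sum>i. ennreal (2 ^ ?n) * a i)"
    using V(3) by (intro suminf_le) auto
  finally have Ea: "emeasure lebesgue E \<le> ennreal (2 ^ ?n) * suminf a"
    by simp
  have inv: "ennreal (1 / 2 ^ ?n) * ennreal (2 ^ ?n) = 1"
    by (subst ennreal_mult[symmetric]) auto
  have A: "ennreal (1 / 2 ^ ?n) * emeasure lebesgue E \<le> suminf a"
    using mult_left_mono[OF Ea, of "ennreal (1 / 2 ^ ?n)"] inv by (simp add: mult.assoc[symmetric])
  have B: "ennreal (min 1 (v / 2 ^ ?n)) \<le> suminf b"
  proof (cases "\<exists>i\<in>I. 1 \<le> diameter (U i)")
    case True
    then obtain i where i: "i \<in> I" "1 \<le> diameter (U i)" by auto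
    then have "1 \<le> b i" by (simp add: b_def)
    also have "b i \<le> suminf b"
      using sum_le_suminf[of b "{i}"] by simp
    finally have "1 \<le> suminf b" .
    moreover have "ennreal (min 1 (v / 2 ^ ?n)) \<le> ennreal 1"
      by (intro ennreal_leI) simp
    ultimately show ?thesis unfolding ennreal_1 by order
  next
    case False
    then have "a i \<le> b i" for i
      using d0[of i] by (auto simp: a_def b_def intro!: ennreal_leI power_decreasing)
    then have "suminf a \<le> suminf b"
      by (intro suminf_le) auto
    moreover have "ennreal (v / 2 ^ ?n) \<le> suminf a"
    proof -
      have "ennreal (v / 2 ^ ?n) = ennreal (1 / 2 ^ ?n) * ennreal v"
        using v by (subst ennreal_mult[symmetric]) auto
      also have "\<dots> \<le> ennreal (1 / 2 ^ ?n) * emeasure lebesgue E"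
        by (intro mult_left_mono v) simp
      finally show ?thesis using A by order
    qed
    moreover have "ennreal (min 1 (v / 2 ^ ?n)) \<le> ennreal (v / 2 ^ ?n)"
      by (intro ennreal_leI) simp
    ultimately show ?thesis by order
  qed
  have "(\<Sum>\<^sub>\<infinity>i\<in>I. ennreal (diameter (U i) ^ ?n + lam * diameter (U i) ^ (?n - 1)))
      = (\<Sum>i. a i + ennreal lam * b i)"
    unfolding infsum_ennreal_eq_suminf
    using d0 lam by (intro suminf_cong) (auto simp: a_def b_def ennreal_mult)
  also have "\<dots> = suminf a + ennreal lam * suminf b"
    by (subst suminf_add[symmetric]) auto
  finally have sum_eq: "(\<Sum>\<^sub>\<infinity>i\<in>I. ennreal (diameter (U i) ^ ?n + lam * diameter (U i) ^ (?n - 1)))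
      = suminf a + ennreal lam * suminf b" .
  have "ennreal (lam * min 1 (v / 2 ^ ?n)) = ennreal lam * ennreal (min 1 (v / 2 ^ ?n))"
    using lam v by (intro ennreal_mult) auto
  then show "ennreal (1 / 2 ^ ?n) * emeasure lebesgue E + ennreal (lam * min 1 (v / 2 ^ ?n))
    \<le> (\<Sum>\<^sub>\<infinity>i\<in>I. ennreal (diameter (U i) ^ ?n + lam * diameter (U i) ^ (?n - 1)))"
    unfolding sum_eq using A B by (simp only: add_mono mult_left_mono zero_le)
qed

section \<open>Hausdorff measure: upper bounds from finite covers, lower bound by projection\<close>

lemma hausdorff_premeasure_le:
  assumes "finite \<V>" "E \<subseteq> \<Union>\<V>" "\<And>V. V \<in> \<V> \<Longrightarrow> bounded V" "\<And>V. V \<in> \<V> \<Longrightarrow> diameter V \<le> d"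
    and "0 < \<delta>" "0 \<le> d" "d \<le> \<delta>"
  shows "hausdorff_premeasure s \<delta> E \<le> ennreal (real (card \<V>) * (unit_ball_vol s * (d / 2) ^ s))"
proof -
  obtain e where e: "bij_betw e {..<card \<V>} \<V>"
    using ex_bij_betw_nat_finite[OF assms(1)] by (auto simp: atLeast0LessThan)
  \<comment> \<open>Padding the enumeration with empty sets costs nothing, since their gauge is 0
    even for \<open>s = 0\<close>.\<close>
  define U where "U i = (if i < card \<V> then e i else {})" for i
  have eV: "e i \<in> \<V>" if "i < card \<V>" for i
    using bij_betw_apply[OF e] that by simp
  have cover: "E \<subseteq> (\<Union>i. U i)"
  proof
    fix x assume "x \<in> E"
    then obtain V where V: "x \<in> V" "V \<in> \<V>" using assms(2) by blast
    then obtain i where "i < card \<V>" "e i = V"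
      using bij_betw_imp_surj_on[OF e] by (metis imageE lessThan_iff)
    then show "x \<in> (\<Union>i. U i)"
      using V by (intro UN_I[of i]) (simp_all add: U_def)
  qed
  have "(\<Sum>i. hausdorff_gauge s (U i)) = (\<Sum>i<card \<V>. hausdorff_gauge s (U i))"
    by (rule suminf_finite) (auto simp: U_def hausdorff_gauge_def)
  also have "\<dots> \<le> (\<Sum>i<card \<V>. ennreal (unit_ball_vol s * (d / 2) ^ s))"
  proof (rule sum_mono)
    fix i assume "i \<in> {..<card \<V>}"
    then have "U i \<in> \<V>" by (simp add: U_def eV)
    then have "(diameter (U i) / 2) ^ s \<le> (d / 2) ^ s"
      using assms by (intro power_mono divide_right_mono) (auto intro: diameter_ge_0)
    then show "hausdorff_gauge s (U i) \<le> ennreal (unit_ball_vol s * (d / 2) ^ s)"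
      by (auto simp: hausdorff_gauge_def intro!: ennreal_leI mult_left_mono)
  qed
  also have "\<dots> = ennreal (real (card \<V>) * (unit_ball_vol s * (d / 2) ^ s))"
    using assms by (simp add: ennreal_mult ennreal_of_nat_eq_real_of_nat)
  finally have *: "(\<Sum>i. hausdorff_gauge s (U i)) \<le> \<dots>" .
  have "\<forall>i. bounded (U i) \<and> diameter (U i) \<le> \<delta>"
    using assms(3,5) order_trans[OF assms(4,7)] eV by (simp add: U_def)
  then have "hausdorff_premeasure s \<delta> E \<le> (\<Sum>i. hausdorff_gauge s (U i))"
    unfolding hausdorff_premeasure_def using cover by (intro Inf_lower) blast
  with * show ?thesis by order
qed

text \<open>At scale \<open>K / m\<close> the \<open>M * m ^ s\<close> sets have gauge at most a
  constant times \<open>(K / m) ^ s\<close> each. The powers of \<open>m\<close> cancel, so one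
  bound holds for every \<open>\<delta>\<close>.\<close>

lemma hausdorff_measure_le:
  assumes K: "0 \<le> K"
    and cover: "\<And>m::nat. 0 < m \<Longrightarrow> \<exists>\<V>. finite \<V> \<and> card \<V> \<le> M * m ^ s \<and> E \<subseteq> \<Union>\<V> \<and>
      (\<forall>V\<in>\<V>. bounded V \<and> diameter V \<le> K / m)"
  shows "hausdorff_measure s E \<le> ennreal (M * (unit_ball_vol s * (K / 2) ^ s))"
  unfolding hausdorff_measure_def
proof (rule SUP_least)
  fix \<delta> :: real assume "\<delta> \<in> {0<..}"
  then have \<delta>: "0 < \<delta>" by simp
  then obtain m :: nat where m: "K / \<delta> < m" using reals_Archimedean2 by blast
  moreover have "0 \<le> K / \<delta>" using K \<delta> by simp
  ultimately have m0: "0 < m" by linarith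
  have Km: "K / m \<le> \<delta>" using m m0 \<delta> by (simp add: field_simps)
  from cover[OF m0] obtain \<V> where \<V>: "finite \<V>" "card \<V> \<le> M * m ^ s" "E \<subseteq> \<Union>\<V>"
      "\<And>V. V \<in> \<V> \<Longrightarrow> bounded V" "\<And>V. V \<in> \<V> \<Longrightarrow> diameter V \<le> K / m"
    by blast
  have "hausdorff_premeasure s \<delta> E \<le> ennreal (real (card \<V>) * (unit_ball_vol s * (K / m / 2) ^ s))"
    using \<V> \<delta> Km K by (intro hausdorff_premeasure_le) auto
  also have "\<dots> \<le> ennreal (real (M * m ^ s) * (unit_ball_vol s * (K / m / 2) ^ s))"
    using \<V>(2) K by (intro ennreal_leI mult_right_mono) (auto simp del: of_nat_mult)
  also have "real (M * m ^ s) * (unit_ball_vol s * (K / m / 2) ^ s) = M * (unit_ball_vol s * (K / 2) ^ s)"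
    using m0 by (simp add: power_divide)
  finally show "hausdorff_premeasure s \<delta> E \<le> ennreal (M * (unit_ball_vol s * (K / 2) ^ s))" .
qed

text \<open>
  In a fixed coordinate direction, every line through the cube leaves \<open>\<Omega>\<close>, so the frontier projects
  onto a face of the cube.  Thickening the projections of the covering sets by the height \<open>t\<close> of the
  cube replaces the \<open>(n - 1)\<close>-dimensional measure of the face by the Lebesgue measure of the cube.
\<close>

lemma hausdorff_measure_frontier_ge:
  fixes \<Omega> :: "(real ^ 'n) set"
  assumes bdd: "bounded \<Omega>" and sub: "cbox a (\<chi> i. a $ i + t) \<subseteq> interior \<Omega>" and t: "0 < t"
  shows "ennreal (unit_ball_vol (real (CARD('n) - 1)) * (t / 4) ^ (CARD('n) - 1))
    \<le> hausdorff_measure (CARD('n) - 1) (frontier \<Omega>)"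
proof -
  let ?s = "CARD('n) - 1"
  define w where "w = unit_ball_vol (real ?s)"
  have w: "0 < w" by (simp add: w_def)
  define j :: 'n where "j = undefined"
  \<comment> \<open>The Hausdorff measure is a supremum over \<open>\<delta>\<close>, so the single
    value \<open>\<delta> = 1\<close> suffices for a lower bound.\<close>
  have "ennreal (w * (t / 4) ^ ?s) \<le> hausdorff_premeasure ?s 1 (frontier \<Omega>)"
    unfolding hausdorff_premeasure_def
  proof (rule Inf_greatest, clarify)
    fix U :: "nat \<Rightarrow> (real ^ 'n) set"
    assume U: "\<forall>i. bounded (U i) \<and> diameter (U i) \<le> 1" and cover: "frontier \<Omega> \<subseteq> (\<Union>i. U i)"
    define d where "d i = diameter (U i)" for i
    have d: "0 \<le> d i" for i
      unfolding d_def using U by (intro diameter_ge_0) auto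
    define x where "x i = (SOME x. x \<in> U i)" for i
    have x: "x i \<in> U i" if "U i \<noteq> {}" for i
      unfolding x_def using that by (simp add: some_in_eq)
    define V where "V i = (if U i = {} then {} else
      cbox (\<chi> k. if k = j then a $ j else x i $ k - d i) (\<chi> k. if k = j then a $ j + t else x i $ k + d i))" for i
    have prod_eq: "(\<Prod>k\<in>(UNIV :: 'n set). if k = j then t else c) = t * c ^ ?s" for c :: real
    proof -
      have "(\<Prod>k\<in>(UNIV :: 'n set). if k = j then t else c) = t * (\<Prod>k\<in>UNIV - {j}. if k = j then t else c)"
        by (subst prod.remove[of UNIV j]) auto
      also have "(\<Prod>k\<in>UNIV - {j}. if k = j then t else c) = (\<Prod>k\<in>UNIV - {j}. c)"
        by (rule prod.cong) auto
      also have "\<dots> = c ^ ?s"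
        by (simp add: card_Diff_singleton)
      finally show ?thesis .
    qed
    \<comment> \<open>A nonempty \<open>V i\<close> has extent \<open>t\<close> in direction
      \<open>j\<close> and \<open>2 * d i\<close> in the others. Writing
      \<open>2 * d i = 4 * (d i / 2)\<close> makes its volume a fixed multiple of the gauge of
      \<open>U i\<close>.\<close>
    have V_meas: "emeasure lebesgue (V i) = ennreal (t * 4 ^ ?s / w) * hausdorff_gauge ?s (U i)" for i
    proof (cases "U i = {}")
      case True
      then show ?thesis by (simp add: V_def hausdorff_gauge_def)
    next
      case False
      define l u :: "real ^ 'n" where "l = (\<chi> k. if k = j then a $ j else x i $ k - d i)"
        and "u = (\<chi> k. if k = j then a $ j + t else x i $ k + d i)"
      have diff: "u $ k - l $ k = (if k = j then t else 2 * d i)" for k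
        by (simp add: l_def u_def)
      have "l $ k \<le> u $ k" for k
        using t d[of i] by (simp add: l_def u_def)
      then have "emeasure lebesgue (V i) = ennreal (\<Prod>k\<in>UNIV. u $ k - l $ k)"
        using False unfolding V_def l_def[symmetric] u_def[symmetric]
        by (simp only: if_False emeasure_lebesgue_cbox_cart)
      also have "\<dots> = ennreal (\<Prod>k\<in>(UNIV :: 'n set). if k = j then t else 2 * d i)"
        by (simp only: diff)
      also have "(\<Prod>k\<in>(UNIV :: 'n set). if k = j then t else 2 * d i) = t * (2 * d i) ^ ?s"
        by (rule prod_eq)
      also have "t * (2 * d i) ^ ?s = (t * 4 ^ ?s / w) * (w * (d i / 2) ^ ?s)"
      proof -
        have "(2 * d i) ^ ?s = (4 * (d i / 2)) ^ ?s" by simp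
        also have "\<dots> = 4 ^ ?s * (d i / 2) ^ ?s" by (rule power_mult_distrib)
        finally show ?thesis using w by simp
      qed
      also have "ennreal \<dots> = ennreal (t * 4 ^ ?s / w) * ennreal (w * (d i / 2) ^ ?s)"
        using t w d[of i] by (intro ennreal_mult) auto
      finally show ?thesis
        using False by (simp add: hausdorff_gauge_def w_def d_def)
    qed
    have "cbox a (\<chi> i. a $ i + t) \<subseteq> (\<Union>i. V i)"
    proof
      fix y assume y: "y \<in> cbox a (\<chi> i. a $ i + t)"
      then have "y \<in> interior \<Omega>" using sub by blast
      then obtain h where h: "y + h *\<^sub>R axis j 1 \<in> frontier \<Omega>"
        using ray_to_frontier[OF bdd, of y "axis j 1"] by (auto simp: axis_eq_0_iff)
      then obtain i where i: "y + h *\<^sub>R axis j 1 \<in> U i" using cover by blast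
      then have "U i \<noteq> {}" by auto
      then have dist: "dist (x i) (y + h *\<^sub>R axis j 1) \<le> d i"
        unfolding d_def using U i x by (intro diameter_bounded_bound) auto
      have "x i $ k - d i \<le> y $ k \<and> y $ k \<le> x i $ k + d i" if "k \<noteq> j" for k
      proof -
        have "\<bar>x i $ k - y $ k\<bar> \<le> d i"
          using component_le_norm_cart[of "x i - (y + h *\<^sub>R axis j 1)" k] dist that
          by (simp add: dist_norm axis_def)
        then show ?thesis by arith
      qed
      moreover have "a $ j \<le> y $ j \<and> y $ j \<le> a $ j + t"
        using y by (simp add: mem_box_cart)
      ultimately have "y \<in> V i"
        using \<open>U i \<noteq> {}\<close> by (simp add: V_def mem_box_cart)
      then show "y \<in> (\<Union>i. V i)" by blast
    qed
    moreover have "V i \<in> sets lebesgue" for i by (simp add: V_def)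
    ultimately have "emeasure lebesgue (cbox a (\<chi> i. a $ i + t)) \<le> (\<Sum>i. emeasure lebesgue (V i))"
      by (intro emeasure_le_suminf_cover)
    also have "emeasure lebesgue (cbox a (\<chi> i. a $ i + t)) = ennreal (t ^ CARD('n))"
      using t by (subst emeasure_lebesgue_cbox_cart) simp_all
    also have "(\<Sum>i. emeasure lebesgue (V i)) = ennreal (t * 4 ^ ?s / w) * (\<Sum>i. hausdorff_gauge ?s (U i))"
      by (simp add: V_meas)
    finally have *: "ennreal (t ^ CARD('n)) \<le> ennreal (t * 4 ^ ?s / w) * (\<Sum>i. hausdorff_gauge ?s (U i))" .
    have pow: "t ^ CARD('n) = t * t ^ ?s"
      by (subst power_eq_if) simp
    have "ennreal (w * (t / 4) ^ ?s) = ennreal (w / (t * 4 ^ ?s)) * ennreal (t ^ CARD('n))"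
      using t w by (subst ennreal_mult[symmetric]) (auto simp: pow power_divide)
    also have "\<dots> \<le> ennreal (w / (t * 4 ^ ?s)) *
        (ennreal (t * 4 ^ ?s / w) * (\<Sum>i. hausdorff_gauge ?s (U i)))"
      by (intro mult_left_mono *) simp
    also have "\<dots> = ennreal (w / (t * 4 ^ ?s) * (t * 4 ^ ?s / w)) * (\<Sum>i. hausdorff_gauge ?s (U i))"
      using t w by (subst ennreal_mult) (auto simp: mult.assoc)
    also have "w / (t * 4 ^ ?s) * (t * 4 ^ ?s / w) = 1"
      using t w by simp
    finally show "ennreal (w * (t / 4) ^ ?s) \<le> (\<Sum>i. hausdorff_gauge ?s (U i))"
      by simp
  qed
  also have "\<dots> \<le> hausdorff_measure ?s (frontier \<Omega>)"
    unfolding hausdorff_measure_def by (rule SUP_upper) simp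
  finally show ?thesis by (simp add: w_def)
qed

section \<open>Geometry of Lipschitz charts\<close>

text \<open>Names the argument at which \<open>above_graph\<close> evaluates \<open>\<phi>\<close>:
  the projection onto the hyperplane that carries the graph.\<close>

definition drop_coord :: "'n \<Rightarrow> real ^ 'n \<Rightarrow> real ^ 'n" where
  "drop_coord j y = (\<chi> i. if i = j then 0 else y $ i)"

lemma drop_coord_nth [simp]: "drop_coord j y $ i = (if i = j then 0 else y $ i)"
  by (simp add: drop_coord_def)

lemma dist_drop_coord_le: "dist (drop_coord j y) (drop_coord j z) \<le> dist y z"
  unfolding dist_norm by (rule norm_le_componentwise_cart) simp

lemma mem_above_graph: "y \<in> above_graph j \<phi> \<longleftrightarrow> \<phi> (drop_coord j y) < y $ j"
  by (simp add: above_graph_def drop_coord_def)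

lemma lipschitz_on_drop_coord:
  assumes "L-lipschitz_on {y. y $ j = 0} \<phi>"
  shows "\<bar>\<phi> (drop_coord j y) - \<phi> (drop_coord j z)\<bar> \<le> L * dist (drop_coord j y) (drop_coord j z)"
  using lipschitz_onD[OF assms, of "drop_coord j y" "drop_coord j z"] by (simp add: dist_real_def)

lemma rigid_motion_dist:
  assumes "rigid_motion f"
  shows "dist (f x) (f y) = dist x y"
  using assms unfolding rigid_motion_def
  by (auto simp: orthogonal_transformation_isometry)

lemma rigid_motion_surj:
  assumes "rigid_motion f"
  shows "\<exists>y. f y = x"
proof -
  obtain a g where g: "orthogonal_transformation g" and f: "f = (\<lambda>x. a + g x)"
    using assms by (auto simp: rigid_motion_def)
  obtain y where "g y = x - a"
    using orthogonal_transformation_surj[OF g] by (metis surjD)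
  then show ?thesis by (intro exI[of _ y]) (simp add: f)
qed

text \<open>A frontier point lies outside the open set \<open>\<Omega>\<close>, hence not above the
  graph. Strictly below the graph it would have a neighbourhood below the graph, and so could not be
  a limit of points of \<open>\<Omega>\<close>.\<close>

lemma frontier_in_chart_on_graph:
  fixes \<Omega> :: "(real ^ 'n) set"
  assumes opn: "open \<Omega>" and f: "rigid_motion f" and lip: "L-lipschitz_on {y. y $ j = 0} \<phi>"
    and chart: "\<Omega> \<inter> ball p r = f ` above_graph j \<phi> \<inter> ball p r"
    and y: "f y \<in> frontier \<Omega>" "f y \<in> ball p r"
  shows "y $ j = \<phi> (drop_coord j y)"
proof (rule antisym)
  have "f y \<notin> \<Omega>"
    using opn y(1) by (simp add: frontier_def interior_open)
  then have "y \<notin> above_graph j \<phi>"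
    using chart y(2) by blast
  then show "y $ j \<le> \<phi> (drop_coord j y)"
    by (simp add: mem_above_graph)
next
  have L: "0 \<le> L" using lip by (rule lipschitz_on_nonneg)
  show "\<phi> (drop_coord j y) \<le> y $ j"
  proof (rule ccontr)
    assume less: "\<not> ?thesis"
    \<comment> \<open>A displacement shorter than \<open>e\<close> changes \<open>y $ j\<close> by
      less than \<open>e\<close> and \<open>\<phi>\<close> by at most \<open>L\<close> times its
      length, which together cannot close the gap to the graph.\<close>
    define e where "e = (\<phi> (drop_coord j y) - y $ j) / (1 + L)"
    have e: "0 < e" using less L by (simp add: e_def)
    have r: "0 < r - dist p (f y)" using y(2) by simp
    have "f y \<in> closure \<Omega>" using y(1) by (simp add: frontier_def)
    then obtain w where w: "w \<in> \<Omega>" "dist w (f y) < min e (r - dist p (f y))"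
      \<comment> \<open>The second term of the minimum keeps \<open>w\<close> inside the chart
        ball.\<close>
      using e r unfolding closure_approachable by (metis min_less_iff_conj)
    have "dist p w < r"
      using w(2) dist_triangle[of p w "f y"] by (simp add: dist_commute)
    then have "w \<in> f ` above_graph j \<phi>" using chart w(1) by auto
    then obtain z where z: "w = f z" "\<phi> (drop_coord j z) < z $ j" by (auto simp: mem_above_graph)
    have zy: "dist z y < e" using w(2) z(1) rigid_motion_dist[OF f, of z y] by simp
    have "\<bar>z $ j - y $ j\<bar> \<le> dist z y"
      using component_le_norm_cart[of "z - y" j] by (simp add: dist_norm)
    moreover have "\<bar>\<phi> (drop_coord j z) - \<phi> (drop_coord j y)\<bar> \<le> L * dist z y"
      using lipschitz_on_drop_coord[OF lip, of z y] mult_left_mono[OF dist_drop_coord_le[of j z y] L]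
      by linarith
    ultimately have "\<phi> (drop_coord j y) - y $ j \<le> (1 + L) * dist z y"
      using z(2) by (simp add: algebra_simps)
    also have "\<dots> < (1 + L) * e" using zy L by simp
    also have "\<dots> = \<phi> (drop_coord j y) - y $ j" using L by (simp add: e_def)
    finally show False by simp
  qed
qed

text \<open>The chart centre lies on the graph; raising it by \<open>r / 2\<close> gives the point
  \<open>z\<close> of the proof. The height over the graph varies with Lipschitz constant at most
  \<open>1 + L\<close>, so it stays positive within \<open>r / 2 / (1 + L)\<close> of
  \<open>z\<close>, and that ball remains inside the chart.\<close>

lemma lipschitz_chart_contains_ball:
  fixes \<Omega> :: "(real ^ 'n) set"
  assumes opn: "open \<Omega>" and p: "p \<in> frontier \<Omega>" and chart: "lipschitz_chart \<Omega> r L p" and r: "0 < r"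
  obtains z where "ball z (r / 2 / (1 + L)) \<subseteq> \<Omega>"
proof -
  obtain f j \<phi> where f: "rigid_motion f" and lip: "L-lipschitz_on {y. y $ j = 0} \<phi>"
    and eq: "\<Omega> \<inter> ball p r = f ` above_graph j \<phi> \<inter> ball p r"
    using chart unfolding lipschitz_chart_def by blast
  have L: "0 \<le> L" using lip by (rule lipschitz_on_nonneg)
  obtain q where q: "f q = p" using rigid_motion_surj[OF f] by blast
  have qj: "q $ j = \<phi> (drop_coord j q)"
    using frontier_in_chart_on_graph[OF opn f lip eq, of q] p r q by simp
  define z where "z = q + (r / 2) *\<^sub>R axis j 1"
  define e where "e = r / 2 / (1 + L)"
  have e: "e \<le> r / 2" "(1 + L) * e = r / 2"
    using L r by (simp_all add: e_def field_simps)
  have zq: "dist q z = r / 2" using r by (simp add: z_def dist_norm norm_axis_1)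
  have "drop_coord j z = drop_coord j q"
    by (simp add: vec_eq_iff z_def axis_def)
  have "ball (f z) e \<subseteq> \<Omega>"
  proof
    fix x assume x: "x \<in> ball (f z) e"
    obtain y where y: "f y = x" using rigid_motion_surj[OF f] by blast
    have yz: "dist y z < e" using x y rigid_motion_dist[OF f, of y z] by (simp add: dist_commute)
    have "\<bar>y $ j - z $ j\<bar> \<le> dist y z"
      using component_le_norm_cart[of "y - z" j] by (simp add: dist_norm)
    moreover have "\<bar>\<phi> (drop_coord j y) - \<phi> (drop_coord j z)\<bar> \<le> L * dist y z"
      using lipschitz_on_drop_coord[OF lip, of y z] mult_left_mono[OF dist_drop_coord_le[of j y z] L]
      by linarith
    moreover have "z $ j = q $ j + r / 2" by (simp add: z_def axis_def)
    moreover have "(1 + L) * dist y z < (1 + L) * e" using yz L by simp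
    ultimately have "\<phi> (drop_coord j y) < y $ j"
      using qj e(2) \<open>drop_coord j z = drop_coord j q\<close> by (simp add: algebra_simps)
    moreover have "dist p x < r"
      using dist_triangle[of q y z] yz zq e(1) rigid_motion_dist[OF f, of q y] q y
      by (simp add: dist_commute)
    ultimately show "x \<in> \<Omega>"
      using eq y by (auto simp: mem_above_graph)
  qed
  then show ?thesis using that unfolding e_def by blast
qed

text \<open>The shadow of the chart ball lies in an \<open>(n - 1)\<close>-dimensional cube of side
  \<open>2 * r\<close>. It is cut into \<open>m ^ (n - 1)\<close> cells of side
  \<open>2 * r / m\<close>, and the pieces of the graph over the cells form the cover. The factor
  \<open>n\<close> comes from bounding the norm by the sum of coordinates, the factor
  \<open>1 + L\<close> from lifting to the graph.\<close>

lemma lipschitz_chart_frontier_cover: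
  fixes \<Omega> :: "(real ^ 'n) set" and r L :: real
  assumes opn: "open \<Omega>" and chart: "lipschitz_chart \<Omega> r L p" and r: "0 < r" and m: "0 < m"
  shows "\<exists>\<V>. finite \<V> \<and> card \<V> \<le> m ^ (CARD('n) - 1) \<and> frontier \<Omega> \<inter> ball p r \<subseteq> \<Union>\<V> \<and>
    (\<forall>V\<in>\<V>. bounded V \<and> diameter V \<le> (1 + L) * (CARD('n) * (2 * r)) / real m)"
proof -
  obtain f j \<phi> where f: "rigid_motion f" and lip: "L-lipschitz_on {y. y $ j = 0} \<phi>"
    and eq: "\<Omega> \<inter> ball p r = f ` above_graph j \<phi> \<inter> ball p r"
    using chart unfolding lipschitz_chart_def by blast
  have L: "0 \<le> L" using lip by (rule lipschitz_on_nonneg)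
  obtain q where q: "f q = p" using rigid_motion_surj[OF f] by blast
  define h where "h = 2 * r / m"
  have h: "0 < h" "m * h = 2 * r" using r m by (simp_all add: h_def)
  define cell where "cell y k = \<lfloor>(y $ k - q $ k + r) / h\<rfloor>" for y k
  define V where "V g = {f y |y. y $ j = \<phi> (drop_coord j y) \<and> (\<forall>k. k \<noteq> j \<longrightarrow> cell y k = int (g k))}"
    for g :: "'n \<Rightarrow> nat"
  \<comment> \<open>Extensional functions on the \<open>n - 1\<close> base directions index the
    cells, which gives exactly \<open>m ^ (n - 1)\<close> of them.\<close>
  define G where "G = (UNIV - {j}) \<rightarrow>\<^sub>E {..<m}"
  have fin: "finite G"
    unfolding G_def by (intro finite_PiE) auto
  have "card G = m ^ (CARD('n) - 1)"
    by (simp add: G_def card_PiE card_Diff_singleton)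
  then have card: "card (V ` G) \<le> m ^ (CARD('n) - 1)"
    using card_image_le[OF fin, of V] by simp
  have close: "dist u v \<le> (1 + L) * (CARD('n) * h)" if uv: "u \<in> V g" "v \<in> V g" for u v g
  proof -
    obtain y where y: "u = f y" "y $ j = \<phi> (drop_coord j y)" "\<And>k. k \<noteq> j \<Longrightarrow> cell y k = int (g k)"
      using uv(1) unfolding V_def by blast
    obtain z where z: "v = f z" "z $ j = \<phi> (drop_coord j z)" "\<And>k. k \<noteq> j \<Longrightarrow> cell z k = int (g k)"
      using uv(2) unfolding V_def by blast
    have coord: "\<bar>(drop_coord j y - drop_coord j z) $ k\<bar> \<le> h" for k
    proof (cases "k = j")
      case True
      then show ?thesis using h by simp
    next
      case False
      define s t where "s = (y $ k - q $ k + r) / h" and "t = (z $ k - q $ k + r) / h"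
      have "\<lfloor>s\<rfloor> = \<lfloor>t\<rfloor>"
        using y(3)[OF False] z(3)[OF False] by (simp add: cell_def s_def t_def)
      then have "\<bar>s - t\<bar> \<le> 1" by linarith
      moreover have "s - t = (y $ k - z $ k) / h"
        by (simp add: s_def t_def diff_divide_distrib[symmetric])
      ultimately have "\<bar>y $ k - z $ k\<bar> \<le> h"
        using h by (simp add: abs_divide)
      then show ?thesis using False by simp
    qed
    have base: "dist (drop_coord j y) (drop_coord j z) \<le> CARD('n) * h"
    proof -
      have "dist (drop_coord j y) (drop_coord j z) \<le> (\<Sum>k\<in>(UNIV :: 'n set). \<bar>(drop_coord j y - drop_coord j z) $ k\<bar>)"
        unfolding dist_norm by (rule norm_le_l1_cart)
      also have "\<dots> \<le> of_nat (card (UNIV :: 'n set)) * h"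
        using coord by (intro sum_bounded_above) blast
      finally show ?thesis by simp
    qed
    have "\<bar>y $ j - z $ j\<bar> \<le> L * (CARD('n) * h)"
      using lipschitz_on_drop_coord[OF lip, of y z] mult_left_mono[OF base L] y(2) z(2) by simp
    have "dist u v = dist y z"
      using y(1) z(1) rigid_motion_dist[OF f, of y z] by simp
    also have "y - z = (drop_coord j y - drop_coord j z) + (y $ j - z $ j) *\<^sub>R axis j 1"
      by (simp add: vec_eq_iff axis_def)
    then have "dist y z \<le> dist (drop_coord j y) (drop_coord j z) + \<bar>y $ j - z $ j\<bar>"
      using norm_triangle_ineq[of "drop_coord j y - drop_coord j z" "(y $ j - z $ j) *\<^sub>R axis j 1"]
      by (simp add: dist_norm norm_axis_1)
    also have "\<dots> \<le> CARD('n) * h + L * (CARD('n) * h)"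
      by (intro add_mono) fact+
    finally show ?thesis by (simp add: algebra_simps)
  qed
  have "frontier \<Omega> \<inter> ball p r \<subseteq> \<Union>(V ` G)"
  proof
    fix x assume x: "x \<in> frontier \<Omega> \<inter> ball p r"
    obtain y where y: "f y = x" using rigid_motion_surj[OF f] by blast
    have on_graph: "y $ j = \<phi> (drop_coord j y)"
      using frontier_in_chart_on_graph[OF opn f lip eq, of y] x y by simp
    have "dist q y < r"
      using x y q rigid_motion_dist[OF f, of q y] by simp
    have bounds: "0 \<le> cell y k \<and> cell y k < int m" for k
    proof -
      have "\<bar>y $ k - q $ k\<bar> < r"
        using component_le_norm_cart[of "y - q" k] \<open>dist q y < r\<close> by (simp add: dist_norm norm_minus_commute)
      \<comment> \<open>The upper inequality is strict because the ball is open, so the cell index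
        \<open>m\<close> does not occur.\<close>
      then have "0 < y $ k - q $ k + r" "y $ k - q $ k + r < 2 * r" by linarith+
      then have "0 < (y $ k - q $ k + r) / h" "(y $ k - q $ k + r) / h < m"
        using h by (simp_all add: pos_divide_less_eq)
      then show ?thesis unfolding cell_def by (simp add: floor_less_iff)
    qed
    define g where "g = (\<lambda>k\<in>UNIV - {j}. nat (cell y k))"
    have "g \<in> G"
      using bounds by (auto simp: g_def G_def nat_less_iff)
    moreover have "x \<in> V g"
      using y on_graph bounds unfolding V_def g_def by (intro CollectI exI[of _ y]) simp
    ultimately show "x \<in> \<Union>(V ` G)" by blast
  qed
  moreover have "bounded (V g)" for g
    unfolding bounded_two_points using close by blast
  moreover have "diameter (V g) \<le> (1 + L) * (CARD('n) * h)" for g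
    using L h close by (intro diameter_le) (auto simp: dist_norm)
  moreover have "(1 + L) * (CARD('n) * h) = (1 + L) * (CARD('n) * (2 * r)) / m"
    by (simp add: h_def)
  ultimately show ?thesis
    using fin card by (intro exI[of _ "V ` G"]) simp
qed

text \<open>The covers of the \<open>N\<close> chart pieces are united, and
  \<open>hausdorff_measure_le\<close> is applied with \<open>M = N\<close>.\<close>

lemma hausdorff_measure_frontier_le:
  fixes \<Omega> :: "(real ^ 'n) set" and r L :: real
  assumes opn: "open \<Omega>" and char: "has_lipschitz_character \<Omega> N r L" and L: "0 \<le> L"
  shows "hausdorff_measure (CARD('n) - 1) (frontier \<Omega>) \<le>
    ennreal (N * (unit_ball_vol (real (CARD('n) - 1)) * ((1 + L) * (CARD('n) * (2 * r)) / 2) ^ (CARD('n) - 1)))"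
proof (rule hausdorff_measure_le)
  obtain p where r: "0 < r" and p: "\<And>k. k < N \<Longrightarrow> lipschitz_chart \<Omega> r L (p k)"
    and cover: "frontier \<Omega> \<subseteq> (\<Union>k<N. ball (p k) r)"
    using char unfolding has_lipschitz_character_def by blast
  show "0 \<le> (1 + L) * (CARD('n) * (2 * r))" using r L by simp
  fix m :: nat assume m: "0 < m"
  have "\<forall>k. \<exists>\<V>. k < N \<longrightarrow> finite \<V> \<and> card \<V> \<le> m ^ (CARD('n) - 1) \<and>
      frontier \<Omega> \<inter> ball (p k) r \<subseteq> \<Union>\<V> \<and>
      (\<forall>V\<in>\<V>. bounded V \<and> diameter V \<le> (1 + L) * (CARD('n) * (2 * r)) / real m)"
    (is "\<forall>k. \<exists>\<V>. k < N \<longrightarrow> ?P k \<V>")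
  proof
    fix k
    show "\<exists>\<V>. k < N \<longrightarrow> ?P k \<V>"
      using lipschitz_chart_frontier_cover[OF opn p[of k] r m] by (cases "k < N") simp_all
  qed
  from choice[OF this] obtain \<V> where \<V>: "\<And>k. k < N \<Longrightarrow> finite (\<V> k)"
      "\<And>k. k < N \<Longrightarrow> card (\<V> k) \<le> m ^ (CARD('n) - 1)"
      "\<And>k. k < N \<Longrightarrow> frontier \<Omega> \<inter> ball (p k) r \<subseteq> \<Union>(\<V> k)"
      "\<And>k V. k < N \<Longrightarrow> V \<in> \<V> k \<Longrightarrow> bounded V \<and> diameter V \<le> (1 + L) * (CARD('n) * (2 * r)) / real m"
    by blast
  let ?W = "\<Union>k<N. \<V> k"
  have "card ?W \<le> (\<Sum>k<N. card (\<V> k))"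
    by (rule card_UN_le) simp
  also have "\<dots> \<le> of_nat (card {..<N}) * m ^ (CARD('n) - 1)"
    using \<V>(2) by (intro sum_bounded_above) auto
  finally have "card ?W \<le> N * m ^ (CARD('n) - 1)" by simp
  moreover have "frontier \<Omega> \<subseteq> \<Union>?W"
  proof
    fix x assume x: "x \<in> frontier \<Omega>"
    then obtain k where "k < N" "x \<in> ball (p k) r" using cover by blast
    then show "x \<in> \<Union>?W" using \<V>(3)[of k] x by blast
  qed
  moreover have "finite ?W" using \<V>(1) by simp
  ultimately show "\<exists>\<V>. finite \<V> \<and> card \<V> \<le> N * m ^ (CARD('n) - 1) \<and> frontier \<Omega> \<subseteq> \<Union>\<V> \<and>
      (\<forall>V\<in>\<V>. bounded V \<and> diameter V \<le> (1 + L) * (CARD('n) * (2 * r)) / real m)"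
    using \<V>(4) by (intro exI[of _ ?W]) blast
qed

section \<open>Diameter of a domain in dimension at least two\<close>

text \<open>
  The radii of the spheres around \<open>x\<close> that meet the \<open>k\<close>-th ball lie in an open interval of length
  \<open>2 * r\<close>, which contains at most one multiple of \<open>2 * r\<close>.
\<close>

lemma sphere_avoiding_balls:
  fixes F :: "'a::metric_space set" and N :: nat
  assumes r: "0 < r" and cover: "F \<subseteq> (\<Union>k<N. ball (p k) r)"
  obtains \<rho> where "0 < \<rho>" "\<rho> \<le> 2 * r * (N + 1)" "sphere x \<rho> \<inter> F = {}"
proof (rule ccontr)
  assume no: "\<not> thesis"
  note avoid = that
  \<comment> \<open>The candidate radii are the first \<open>N + 1\<close> positive multiples of
    \<open>2 * r\<close>. If all of them fail, each is assigned one of \<open>N\<close> balls, and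
    two radii share a ball by the pigeonhole principle.\<close>
  have "\<exists>k<N. \<bar>2 * r * m - dist x (p k)\<bar> < r" if m: "m \<in> {1..N + 1}" for m :: nat
  proof -
    have "real m \<le> real (N + 1)" using m by (subst of_nat_le_iff) simp
    then have "2 * r * m \<le> 2 * r * (N + 1)" using r by simp
    then have "sphere x (2 * r * m) \<inter> F \<noteq> {}"
      using avoid[of "2 * r * m"] no m r by auto
    then obtain y where "y \<in> sphere x (2 * r * m)" "y \<in> F" by blast
    moreover from this obtain k where "k < N" "y \<in> ball (p k) r" using cover by blast
    ultimately have y: "dist x y = 2 * r * m" "k < N" "dist (p k) y < r" by simp_all
    then have "\<bar>dist x y - dist x (p k)\<bar> < r"
      using dist_triangle[of x y "p k"] dist_triangle[of x "p k" y]
      by (simp add: dist_commute abs_less_iff)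
    then show ?thesis using y by auto
  qed
  then obtain k where k: "\<And>m. m \<in> {1..N + 1} \<Longrightarrow> k m < N \<and> \<bar>2 * r * real m - dist x (p (k m))\<bar> < r"
    by metis
  have "card (k ` {1..N + 1}) \<le> card {..<N}"
    using k by (intro card_mono) auto
  then have "\<not> inj_on k {1..N + 1}"
    using card_image[of k "{1..N + 1}"] by auto
  then obtain m m' where mm: "m \<in> {1..N + 1}" "m' \<in> {1..N + 1}" "k m = k m'" "m < m'"
    unfolding inj_on_def by (metis linorder_neqE_nat)
  have "2 * r * real m' - 2 * r * real m < 2 * r"
    using k[OF mm(1)] k[OF mm(2)] mm(3) by (simp add: abs_less_iff)
  moreover have "2 * r * (real m + 1) \<le> 2 * r * real m'"
    using mm(4) r by (intro mult_left_mono) auto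
  ultimately show False by (simp add: algebra_simps)
qed

text \<open>
  A connected set of large diameter would have to contain a sphere around the highest frontier
  point, but above the top of that sphere there would be a still higher frontier point.
\<close>

lemma bounded_domain_subset_ball:
  fixes \<Omega> :: "(real ^ 'n) set" and N :: nat
  assumes dom: "bounded_domain \<Omega>" and r: "0 < r" and n: "2 \<le> CARD('n)"
    and cover: "frontier \<Omega> \<subseteq> (\<Union>k<N. ball (p k) r)"
  obtains x where "\<Omega> \<subseteq> ball x (2 * r * (N + 1))"
proof -
  have \<Omega>: "open \<Omega>" "connected \<Omega>" "\<Omega> \<noteq> {}" "bounded \<Omega>"
    using dom by (auto simp: bounded_domain_def)
  define j :: 'n where "j = undefined"
  have "frontier \<Omega> \<noteq> {}"
    using \<Omega> by (auto simp: frontier_eq_empty)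
  moreover have "continuous_on (frontier \<Omega>) (\<lambda>y. y $ j)"
    by (intro continuous_intros)
  ultimately obtain x where x: "x \<in> frontier \<Omega>" "\<And>y. y \<in> frontier \<Omega> \<Longrightarrow> y $ j \<le> x $ j"
    using continuous_attains_sup[OF compact_frontier_bounded[OF \<Omega>(4)]] by blast
  obtain \<rho> where \<rho>: "0 < \<rho>" "\<rho> \<le> 2 * r * (N + 1)" "sphere x \<rho> \<inter> frontier \<Omega> = {}"
    using sphere_avoiding_balls[OF r cover] by blast
  define t where "t = x + \<rho> *\<^sub>R axis j 1"
  have "t \<notin> \<Omega>"
  proof
    assume "t \<in> \<Omega>"
    then have "t \<in> interior \<Omega>" using \<Omega>(1) by (simp add: interior_open)
    then obtain h where "0 < h" "t + h *\<^sub>R axis j 1 \<in> frontier \<Omega>"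
      using ray_to_frontier[OF \<Omega>(4), of t "axis j 1"] by (auto simp: axis_eq_0_iff)
    then show False
      using x(2)[of "t + h *\<^sub>R axis j 1"] \<rho>(1) by (simp add: t_def axis_def)
  qed
  moreover have "t \<in> sphere x \<rho>"
    using \<rho>(1) by (simp add: t_def dist_norm norm_axis_1)
  \<comment> \<open>Dimension at least two enters here: on a line the sphere is a pair of
    points.\<close>
  moreover have "connected (sphere x \<rho>)"
    using n by (intro connected_sphere) simp
  \<comment> \<open>A connected set that avoids the frontier lies in \<open>\<Omega>\<close> or
    misses it, and \<open>t\<close> excludes the first. The same alternative, with the roles
    exchanged, later places \<open>\<Omega>\<close> inside the ball.\<close>
  ultimately have disj: "sphere x \<rho> \<inter> \<Omega> = {}"
    using \<rho>(3) connected_Int_frontier by blast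
  have "x \<in> closure \<Omega>" using x(1) by (simp add: frontier_def)
  then obtain w where "w \<in> \<Omega>" "dist w x < \<rho>"
    using \<rho>(1) unfolding closure_approachable by blast
  then have "\<Omega> \<inter> ball x \<rho> \<noteq> {}" by (auto simp: dist_commute)
  moreover have "\<Omega> \<inter> frontier (ball x \<rho>) = {}"
    using disj \<rho>(1) by (simp add: frontier_ball Int_commute)
  ultimately have "\<Omega> \<subseteq> ball x \<rho>"
    using connected_Int_frontier[OF \<Omega>(2), of "ball x \<rho>"] by blast
  also have "\<dots> \<subseteq> ball x (2 * r * (N + 1))"
    using \<rho>(2) by (rule subset_ball)
  finally show ?thesis by (rule that)
qed

section \<open>Comparison of balls and cubes\<close>

lemma dist_cbox_cube_le:
  fixes a :: "real ^ 'n" and s :: real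
  assumes "x \<in> cbox a (\<chi> i. a $ i + s)" "y \<in> cbox a (\<chi> i. a $ i + s)"
  shows "dist x y \<le> CARD('n) * s"
proof -
  have "\<bar>(x - y) $ i\<bar> \<le> s" for i
  proof -
    have "a $ i \<le> x $ i" "x $ i \<le> a $ i + s" "a $ i \<le> y $ i" "y $ i \<le> a $ i + s"
      using assms by (simp_all add: mem_box_cart)
    then show ?thesis by simp
  qed
  then have "(\<Sum>i\<in>(UNIV :: 'n set). \<bar>(x - y) $ i\<bar>) \<le> of_nat (card (UNIV :: 'n set)) * s"
    by (intro sum_bounded_above)
  then show ?thesis
    using norm_le_l1_cart[of "x - y"] by (simp add: dist_norm)
qed

lemma diameter_cbox_cube_le:
  fixes a :: "real ^ 'n" and s :: real
  assumes "0 \<le> s"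
  shows "diameter (cbox a (\<chi> i. a $ i + s)) \<le> CARD('n) * s"
  using assms dist_cbox_cube_le[of _ a s] by (intro diameter_le) (auto simp: dist_norm)

lemma ball_subset_box_cube:
  fixes x :: "real ^ 'n" and \<rho> :: real
  shows "ball x \<rho> \<subseteq> box (\<chi> i. x $ i - \<rho>) (\<chi> i. (\<chi> i. x $ i - \<rho>) $ i + 2 * \<rho>)"
proof
  fix y assume y: "y \<in> ball x \<rho>"
  have "x $ i - \<rho> < y $ i \<and> y $ i < x $ i + \<rho>" for i
  proof -
    have "\<bar>x $ i - y $ i\<bar> < \<rho>"
      using y component_le_norm_cart[of "x - y" i] by (simp add: dist_norm)
    then show ?thesis by arith
  qed
  then show "y \<in> box (\<chi> i. x $ i - \<rho>) (\<chi> i. (\<chi> i. x $ i - \<rho>) $ i + 2 * \<rho>)"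
    by (simp add: mem_box_cart add.commute)
qed

lemma covering_family_bounded:
  assumes "\<F> \<in> {open_balls, closed_balls, open_cubes, closed_cubes}" "U \<in> \<F>"
  shows "bounded U"
  using assms by (auto simp: open_balls_def closed_balls_def open_cubes_def closed_cubes_def)

text \<open>Serves all four families at once: balls use radius \<open>\<rho>\<close> and cubes use
  side \<open>2 * \<rho>\<close>, whose diameter is at most \<open>n\<close> times the side.\<close>

lemma covering_family_contains_ball:
  fixes x :: "real ^ 'n" and \<rho> :: real
  assumes \<F>: "\<F> \<in> {open_balls, closed_balls, open_cubes, closed_cubes}" and \<rho>: "0 < \<rho>"
  obtains U where "U \<in> \<F>" "ball x \<rho> \<subseteq> U" "diameter U \<le> 2 * CARD('n) * \<rho>"
proof -
  have n: "2 * \<rho> \<le> 2 * CARD('n) * \<rho>"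
    using \<rho> by (simp add: Suc_leI)
  define a where "a = (\<chi> i. x $ i - \<rho>)"
  define B C where "B = box a (\<chi> i. a $ i + 2 * \<rho>)" and "C = cbox a (\<chi> i. a $ i + 2 * \<rho>)"
  have B: "ball x \<rho> \<subseteq> B"
    unfolding B_def a_def by (rule ball_subset_box_cube)
  have BC: "B \<subseteq> C"
    unfolding B_def C_def by (rule box_subset_cbox)
  have C: "diameter C \<le> 2 * CARD('n) * \<rho>"
    using diameter_cbox_cube_le[of "2 * \<rho>" a] \<rho> by (simp add: C_def algebra_simps)
  have "diameter B \<le> diameter C"
    using BC by (intro diameter_subset) (simp_all add: C_def)
  then have "diameter B \<le> 2 * CARD('n) * \<rho>"
    using C by linarith
  moreover have "B \<in> open_cubes" "C \<in> closed_cubes"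
    using \<rho> unfolding B_def C_def open_cubes_def closed_cubes_def
    by (intro CollectI exI[of _ a] exI[of _ "2 * \<rho>"]; simp)+
  moreover have "ball x \<rho> \<in> open_balls" "cball x \<rho> \<in> closed_balls"
    using \<rho> unfolding open_balls_def closed_balls_def by blast+
  moreover have "diameter (ball x \<rho>) \<le> 2 * CARD('n) * \<rho>" "diameter (cball x \<rho>) \<le> 2 * CARD('n) * \<rho>"
    using n \<rho> by simp_all
  ultimately have "\<exists>U\<in>\<F>. ball x \<rho> \<subseteq> U \<and> diameter U \<le> 2 * CARD('n) * \<rho>"
    using \<F> B C order_trans[OF B BC] ball_subset_cball[of x \<rho>] by blast
  then show ?thesis using that by blast
qed

text \<open>With corner \<open>z\<close> and side \<open>e / n / 2\<close>, every point of the cube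
  is within \<open>e / 2\<close> of \<open>z\<close>.\<close>

lemma cube_subset_ball:
  fixes z :: "real ^ 'n" and e :: real
  assumes "0 < e"
  obtains a where "cbox a (\<chi> i. a $ i + e / CARD('n) / 2) \<subseteq> ball z e"
proof -
  define s where "s = e / CARD('n) / 2"
  have s: "0 < s" "CARD('n) * s = e / 2" using assms by (simp_all add: s_def)
  have "z \<in> cbox z (\<chi> i. z $ i + s)"
    using s by (simp add: mem_box_cart)
  then have "dist z y \<le> e / 2" if "y \<in> cbox z (\<chi> i. z $ i + s)" for y
    using dist_cbox_cube_le[of z z s y] that s(2) by simp
  then have "cbox z (\<chi> i. z $ i + s) \<subseteq> ball z e"
    using assms by fastforce
  then show ?thesis using that unfolding s_def by blast
qed

section \<open>Enclosing ball controlled by the volume\<close>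

text \<open>On a line connected sets are convex, so \<open>\<Omega>\<close> contains the segment
  between the two points, whose length is its volume.\<close>

lemma dist_le_emeasure_connected_1:
  fixes \<Omega> :: "(real ^ 'n) set"
  assumes n: "CARD('n) = 1" and conn: "connected \<Omega>" and meas: "\<Omega> \<in> sets lebesgue"
    and xy: "x \<in> \<Omega>" "y \<in> \<Omega>"
  shows "ennreal (dist x y) \<le> emeasure lebesgue \<Omega>"
proof -
  obtain j :: 'n where j: "UNIV = {j}" using n card_1_singletonE by blast
  have only: "i = j" for i using j by blast
  have eq: "u = v \<longleftrightarrow> u $ j = v $ j" for u v :: "real ^ 'n"
  proof
    assume "u $ j = v $ j"
    then have "u $ i = v $ i" for i by (subst (1 2) only)
    then show "u = v" by (simp add: vec_eq_iff)
  qed simp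
  have "DIM(real ^ 'n) = 1" using n by simp
  then have "convex \<Omega>" using conn connected_convex_1_gen by blast
  have *: "ennreal (dist x y) \<le> emeasure lebesgue \<Omega>"
    if xy: "x \<in> \<Omega>" "y \<in> \<Omega>" and le: "x $ j \<le> y $ j" for x y
  proof (cases "x = y")
    case False
    then have less: "x $ j < y $ j" using le by (simp add: eq)
    have "cbox x y \<subseteq> \<Omega>"
    proof
      fix z assume z: "z \<in> cbox x y"
      define u where "u = (z $ j - x $ j) / (y $ j - x $ j)"
      have "x $ j \<le> z $ j" "z $ j \<le> y $ j" using z by (simp_all add: mem_box_cart)
      then have u: "0 \<le> u" "u \<le> 1" using less by (simp_all add: u_def)
      have "u * (y $ j - x $ j) = z $ j - x $ j" using less by (simp add: u_def)
      then have "z = (1 - u) *\<^sub>R x + u *\<^sub>R y" by (simp add: eq algebra_simps)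
      then show "z \<in> \<Omega>"
        using convexD_alt[OF \<open>convex \<Omega>\<close> xy u] by simp
    qed
    then have "emeasure lebesgue (cbox x y) \<le> emeasure lebesgue \<Omega>"
      using meas by (rule emeasure_mono)
    moreover have "emeasure lebesgue (cbox x y) = ennreal (y $ j - x $ j)"
    proof -
      have "x $ i \<le> y $ i" for i using le by (subst (1 2) only)
      then have "emeasure lebesgue (cbox x y) = ennreal (\<Prod>i\<in>UNIV. y $ i - x $ i)"
        by (rule emeasure_lebesgue_cbox_cart)
      then show ?thesis unfolding j by simp
    qed
    moreover have "dist x y \<le> y $ j - x $ j"
      using norm_le_l1_cart[of "x - y"] less unfolding j dist_norm by simp
    then have "ennreal (dist x y) \<le> ennreal (y $ j - x $ j)"
      by (rule ennreal_leI)
    ultimately show ?thesis by order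
  qed simp
  show ?thesis
    using *[of x y] *[of y x] xy by (cases "x $ j \<le> y $ j") (simp_all add: dist_commute)
qed

text \<open>The summands of \<open>C\<close> serve different cases. For \<open>n = 1\<close> the
  radius is twice the diameter, and \<open>4\<close> dominates its ratio to the volume. For
  \<open>n \<ge> 2\<close> the radius is \<open>R\<close>, and the other two terms bound
  \<open>R ^ n\<close> relative to the volume, which is at least \<open>t ^ n\<close>, and
  \<open>R ^ (n - 1)\<close> itself.\<close>

lemma bounded_domain_enclosing_ball:
  fixes \<Omega> :: "(real ^ 'n) set" and r L :: real and N :: nat
  assumes dom: "bounded_domain \<Omega>" and char: "has_lipschitz_character \<Omega> N r L"
    and t: "0 < t" "ennreal (t ^ CARD('n)) \<le> emeasure lebesgue \<Omega>"
  defines "R \<equiv> 2 * r * (N + 1)"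
  defines "C \<equiv> 4 + R ^ CARD('n) / t ^ CARD('n) + R ^ (CARD('n) - 1)"
  obtains x \<rho> where "0 < \<rho>" "\<Omega> \<subseteq> ball x \<rho>" "\<rho> ^ (CARD('n) - 1) \<le> C"
    "ennreal (\<rho> ^ CARD('n)) \<le> ennreal C * emeasure lebesgue \<Omega>"
proof -
  have \<Omega>: "open \<Omega>" "connected \<Omega>" "\<Omega> \<noteq> {}" "bounded \<Omega>"
    using dom by (auto simp: bounded_domain_def)
  obtain p where r: "0 < r" and cover: "frontier \<Omega> \<subseteq> (\<Union>k<N. ball (p k) r)"
    using char unfolding has_lipschitz_character_def by blast
  have R: "0 < R" using r by (simp add: R_def)
  have C: "4 \<le> C" "R ^ CARD('n) / t ^ CARD('n) \<le> C" "R ^ (CARD('n) - 1) \<le> C"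
    using R t by (simp_all add: C_def)
  show ?thesis
  proof (cases "CARD('n) = 1")
    case True
    define D where "D = diameter \<Omega>"
    have "0 < D"
    proof -
      obtain z e where "0 < e" "ball z e \<subseteq> \<Omega>"
        using \<Omega>(1,3) by (metis equals0I open_contains_ball)
      then have "2 * e \<le> D"
        using diameter_subset[of "ball z e" \<Omega>] \<Omega>(4) by (simp add: D_def)
      then show ?thesis using \<open>0 < e\<close> by linarith
    qed
    \<comment> \<open>Half the diameter is exceeded by some distance in \<open>\<Omega>\<close>;
      this loss accounts for the \<open>4\<close> in \<open>2 * D = 4 * (D / 2)\<close>.\<close>
    then obtain x y where xy: "x \<in> \<Omega>" "y \<in> \<Omega>" "D / 2 < dist x y"
      using diameter_lower_bounded[of \<Omega> "D / 2"] \<Omega>(4) unfolding D_def by auto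
    have "\<Omega> \<subseteq> ball x (2 * D)"
    proof
      fix w assume "w \<in> \<Omega>"
      then have "dist x w \<le> D"
        unfolding D_def using \<Omega>(4) xy(1) by (intro diameter_bounded_bound)
      then show "w \<in> ball x (2 * D)" using \<open>0 < D\<close> by simp
    qed
    moreover have "ennreal ((2 * D) ^ CARD('n)) \<le> ennreal C * emeasure lebesgue \<Omega>"
    proof -
      have "ennreal ((2 * D) ^ CARD('n)) = ennreal 4 * ennreal (D / 2)"
        using \<open>0 < D\<close> True by (subst ennreal_mult[symmetric]) simp_all
      also have "\<dots> \<le> ennreal C * ennreal (dist x y)"
        using C(1) xy(3) by (intro mult_mono ennreal_leI) auto
      also have "\<dots> \<le> ennreal C * emeasure lebesgue \<Omega>"
        using dist_le_emeasure_connected_1[OF True \<Omega>(2) _ xy(1,2)] \<Omega>(1) by (intro mult_left_mono) auto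
      finally show ?thesis .
    qed
    ultimately show ?thesis
      using that[of "2 * D" x] \<open>0 < D\<close> True C(1) by simp
  next
    case False
    then have "2 \<le> CARD('n)"
      using zero_less_card_finite[where 'a = 'n] by linarith
    then obtain x where x: "\<Omega> \<subseteq> ball x R"
      using bounded_domain_subset_ball[OF dom r _ cover] unfolding R_def by blast
    have "ennreal (R ^ CARD('n)) = ennreal (R ^ CARD('n) / t ^ CARD('n)) * ennreal (t ^ CARD('n))"
      using R t by (subst ennreal_mult[symmetric]) simp_all
    also have "\<dots> \<le> ennreal C * emeasure lebesgue \<Omega>"
      using C(2) t(2) by (intro mult_mono ennreal_leI) auto
    finally show ?thesis
      using that[of R x] R x C(3) by blast
  qed
qed

section \<open>Choice of the constants and the two-sided estimate\<close>

theorem corollary4p3: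
  fixes \<F> :: "(real ^ 'n) set set" and N :: nat and r L :: real
  assumes "\<F> \<in> {open_balls, closed_balls, open_cubes, closed_cubes}"
  shows "\<exists>c>0. \<exists>C>0. \<forall>\<Omega> :: (real ^ 'n) set.
    bounded_domain \<Omega> \<and> has_lipschitz_character \<Omega> N r L \<longrightarrow>
    (\<forall>lam>0.
       ennreal c * (emeasure lebesgue \<Omega> + ennreal lam * hausdorff_measure (CARD('n) - 1) (frontier \<Omega>))
         \<le> mixed_content \<F> lam \<Omega> \<and>
       mixed_content \<F> lam \<Omega>
         \<le> ennreal C * (emeasure lebesgue \<Omega> + ennreal lam * hausdorff_measure (CARD('n) - 1) (frontier \<Omega>)))"
proof -
  let ?n = "CARD('n)" and ?s = "CARD('n) - 1"
  \<comment> \<open>Side of a cube that fits into the ball of radius \<open>r / 2 / (1 + L)\<close>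
    supplied by any chart.\<close>
  define t where "t = r / 2 / (1 + L) / ?n / 2"
  define w where "w = unit_ball_vol (real ?s)"
  \<comment> \<open>\<open>h1\<close> and \<open>h2\<close> are the lower and upper bounds for the
    Hausdorff measure of the frontier; \<open>lam * b\<close> is the lower order term of
    \<open>mixed_content_ge\<close> for \<open>v = t ^ n\<close>.\<close>
  define h1 where "h1 = w * (t / 4) ^ ?s"
  define h2 where "h2 = N * (w * ((1 + L) * (?n * (2 * r)) / 2) ^ ?s)"
  define b where "b = min 1 (t ^ ?n / 2 ^ ?n)"
  define R where "R = 2 * r * (N + 1)"
  define C0 where "C0 = 4 + R ^ ?n / t ^ ?n + R ^ ?s"
  \<comment> \<open>The first entry handles the volume, the second ensures
    \<open>c * h2 \<le> b\<close>. The absolute value keeps the denominator positive for arbitrary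
    \<open>r\<close> and \<open>L\<close>.\<close>
  define c where "c = min (1 / 2 ^ ?n) (b / (\<bar>h2\<bar> + 1))"
  define C where "C = max ((2 * ?n) ^ ?n * C0) ((2 * ?n) ^ ?s * C0 / h1)"
  \<comment> \<open>Positivity of the constants is part of the claim because the signs of
    \<open>r\<close> and \<open>L\<close> become known only once some domain with this character is
    given.\<close>
  have main: "0 < c \<and> 0 < C \<and> (\<forall>lam>0.
       ennreal c * (emeasure lebesgue \<Omega> + ennreal lam * hausdorff_measure ?s (frontier \<Omega>))
         \<le> mixed_content \<F> lam \<Omega> \<and>
       mixed_content \<F> lam \<Omega>
         \<le> ennreal C * (emeasure lebesgue \<Omega> + ennreal lam * hausdorff_measure ?s (frontier \<Omega>)))"
    if dom: "bounded_domain \<Omega>" and char: "has_lipschitz_character \<Omega> N r L" for \<Omega> :: "(real ^ 'n) set"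
  proof -
    let ?V = "emeasure lebesgue \<Omega>" and ?H = "hausdorff_measure ?s (frontier \<Omega>)"
    have \<Omega>: "open \<Omega>" "connected \<Omega>" "\<Omega> \<noteq> {}" "bounded \<Omega>"
      using dom by (auto simp: bounded_domain_def)
    obtain p where r: "0 < r"
      and p: "\<And>k. k < N \<Longrightarrow> p k \<in> frontier \<Omega> \<and> lipschitz_chart \<Omega> r L (p k)"
      and cover: "frontier \<Omega> \<subseteq> (\<Union>k<N. ball (p k) r)"
      using char unfolding has_lipschitz_character_def by blast
    have "frontier \<Omega> \<noteq> {}"
      using \<Omega> by (auto simp: frontier_eq_empty)
    \<comment> \<open>The frontier of a nonempty bounded open set is nonempty, so at least one chart
      exists; it also yields \<open>0 \<le> L\<close>.\<close>
    then obtain k where "k < N" using cover by blast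
    then have pk: "p k \<in> frontier \<Omega>" "lipschitz_chart \<Omega> r L (p k)" using p by auto
    then have L: "0 \<le> L"
      unfolding lipschitz_chart_def using lipschitz_on_nonneg by blast
    obtain z where "ball z (r / 2 / (1 + L)) \<subseteq> \<Omega>"
      using lipschitz_chart_contains_ball[OF \<Omega>(1) pk r] by blast
    moreover obtain a where "cbox a (\<chi> i. a $ i + t) \<subseteq> ball z (r / 2 / (1 + L))"
      using cube_subset_ball[of "r / 2 / (1 + L)" z] r L unfolding t_def by auto
    ultimately have cube: "cbox a (\<chi> i. a $ i + t) \<subseteq> \<Omega>" by blast
    have t: "0 < t" using r L by (simp add: t_def)
    have w: "0 < w" by (simp add: w_def)
    have R: "0 < R" using r by (simp add: R_def)
    have h1: "0 < h1" using w t by (simp add: h1_def)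
    have h2: "0 \<le> h2" using w r L by (simp add: h2_def)
    have b: "0 < b" using t by (simp add: b_def)
    have C0: "0 < C0" using R t by (simp add: C0_def add_pos_pos)
    have c: "0 < c" "c \<le> 1 / 2 ^ ?n" "c * h2 \<le> b"
    proof -
      show "0 < c" using b by (simp add: c_def)
      show "c \<le> 1 / 2 ^ ?n" by (simp add: c_def)
      have "c * h2 \<le> b / (\<bar>h2\<bar> + 1) * (\<bar>h2\<bar> + 1)"
        using h2 b by (intro mult_mono) (simp_all add: c_def)
      then show "c * h2 \<le> b" by simp
    qed
    have C: "0 < C" "(2 * ?n) ^ ?n * C0 \<le> C" "(2 * ?n) ^ ?s * C0 / h1 \<le> C"
      using C0 by (auto simp: C_def less_max_iff_disj)
    have V: "ennreal (t ^ ?n) \<le> ?V"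
    proof -
      have "ennreal (t ^ ?n) = emeasure lebesgue (cbox a (\<chi> i. a $ i + t))"
        using t by (subst emeasure_lebesgue_cbox_cart) simp_all
      also have "\<dots> \<le> ?V"
        using cube \<Omega>(1) by (intro emeasure_mono) auto
      finally show ?thesis .
    qed
    have H1: "ennreal h1 \<le> ?H"
      using hausdorff_measure_frontier_ge[OF \<Omega>(4), of a t] cube t \<Omega>(1)
      by (simp add: h1_def w_def interior_open)
    have H2: "?H \<le> ennreal h2"
      using hausdorff_measure_frontier_le[OF \<Omega>(1) char L] by (simp add: h2_def w_def)
    obtain x \<rho> where \<rho>: "0 < \<rho>" "\<Omega> \<subseteq> ball x \<rho>" "\<rho> ^ ?s \<le> C0" "ennreal (\<rho> ^ ?n) \<le> ennreal C0 * ?V"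
      using bounded_domain_enclosing_ball[OF dom char t V] unfolding C0_def R_def by blast
    obtain U where U: "U \<in> \<F>" "ball x \<rho> \<subseteq> U" "diameter U \<le> 2 * ?n * \<rho>"
      using covering_family_contains_ball[OF assms \<rho>(1)] by blast
    have U0: "0 \<le> diameter U"
      using covering_family_bounded[OF assms U(1)] by (rule diameter_ge_0)
    have pow: "diameter U ^ k \<le> (2 * ?n) ^ k * \<rho> ^ k" for k
      using power_mono[OF U(3) U0, of k] by (simp add: power_mult_distrib)
    have bound: "ennreal c * (?V + ennreal lam * ?H) \<le> mixed_content \<F> lam \<Omega>
        \<and> mixed_content \<F> lam \<Omega> \<le> ennreal C * (?V + ennreal lam * ?H)" if lam: "0 < lam" for lam
    proof
      have "ennreal c * (ennreal lam * ?H) \<le> ennreal c * (ennreal lam * ennreal h2)"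
        by (intro mult_left_mono H2) simp_all
      also have "\<dots> = ennreal (lam * (c * h2))"
        using c(1) lam h2 by (simp add: ennreal_mult[symmetric] mult.left_commute)
      also have "\<dots> \<le> ennreal (lam * b)"
        using c(3) lam by (intro ennreal_leI mult_left_mono) simp_all
      finally have "ennreal c * (?V + ennreal lam * ?H) \<le> ennreal (1 / 2 ^ ?n) * ?V + ennreal (lam * b)"
        unfolding distrib_left using c(2) by (intro add_mono mult_right_mono ennreal_leI) simp_all
      also have "\<dots> \<le> mixed_content \<F> lam \<Omega>"
        unfolding b_def using covering_family_bounded[OF assms] t V lam by (intro mixed_content_ge) simp_all
      finally show "ennreal c * (?V + ennreal lam * ?H) \<le> mixed_content \<F> lam \<Omega>" .
    next
      have vol: "ennreal (diameter U ^ ?n) \<le> ennreal C * ?V"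
      proof -
        have "ennreal (diameter U ^ ?n) \<le> ennreal ((2 * ?n) ^ ?n) * ennreal (\<rho> ^ ?n)"
          using pow[of ?n] \<rho>(1) by (simp add: ennreal_mult[symmetric] ennreal_leI)
        also have "\<dots> \<le> ennreal ((2 * ?n) ^ ?n) * (ennreal C0 * ?V)"
          by (intro mult_left_mono \<rho>(4)) simp
        also have "\<dots> = ennreal ((2 * ?n) ^ ?n * C0) * ?V"
          using C0 by (subst ennreal_mult) (simp_all add: mult.assoc)
        also have "\<dots> \<le> ennreal C * ?V"
          by (intro mult_right_mono ennreal_leI C(2)) simp
        finally show ?thesis .
      qed
      \<comment> \<open>Here both sides are compared with constants: \<open>\<rho> ^ (n - 1)\<close>
        is at most \<open>C0\<close> and the frontier has measure at least
        \<open>h1\<close>.\<close>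
      have area: "ennreal (diameter U ^ ?s) \<le> ennreal C * ?H"
      proof -
        have "diameter U ^ ?s \<le> (2 * ?n) ^ ?s * \<rho> ^ ?s"
          by (rule pow)
        also have "\<dots> \<le> (2 * ?n) ^ ?s * C0"
          by (intro mult_left_mono \<rho>(3)) simp
        also have "\<dots> = (2 * ?n) ^ ?s * C0 / h1 * h1"
          using h1 by simp
        also have "\<dots> \<le> C * h1"
          using C(3) h1 by (intro mult_right_mono) simp_all
        finally have "ennreal (diameter U ^ ?s) \<le> ennreal C * ennreal h1"
          using C(1) h1 by (simp add: ennreal_mult[symmetric] ennreal_leI)
        also have "\<dots> \<le> ennreal C * ?H"
          by (intro mult_left_mono H1) simp
        finally show ?thesis .
      qed
      have "mixed_content \<F> lam \<Omega> \<le> ennreal (diameter U ^ ?n + lam * diameter U ^ ?s)"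
        using U(1,2) \<rho>(2) by (intro mixed_content_le) auto
      also have "\<dots> = ennreal (diameter U ^ ?n) + ennreal lam * ennreal (diameter U ^ ?s)"
        using U0 lam by (simp add: ennreal_mult)
      also have "\<dots> \<le> ennreal C * ?V + ennreal lam * (ennreal C * ?H)"
        by (intro add_mono mult_left_mono vol area) simp
      also have "\<dots> = ennreal C * (?V + ennreal lam * ?H)"
        by (simp add: distrib_left mult.left_commute)
      finally show "mixed_content \<F> lam \<Omega> \<le> ennreal C * (?V + ennreal lam * ?H)" .
    qed
    then show ?thesis using c(1) C(1) by blast
  qed
  show ?thesis
  proof (cases "\<exists>\<Omega> :: (real ^ 'n) set. bounded_domain \<Omega> \<and> has_lipschitz_character \<Omega> N r L")
    case True
    then show ?thesis using main by blast
  next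
    \<comment> \<open>Without any domain of this character the estimate is vacuous, and any positive
      constants will do.\<close>
    case False
    then show ?thesis by (intro exI[of _ "1 :: real"] conjI zero_less_one) blast
  qed
qed

end
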